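(* Let $q,\alpha,z$ be nonzero complex numbers with $|q|<1$, $|zq|<1$ and $|zq/\alpha|<1$. Then $$F(\alpha,z;q)=F\left(\frac{1}{\alpha},-\frac{z}{\alpha};q\right).$$
   Context: Notation: $(a;q)_n=\prod_{m=0}^{n-1}(1-aq^m)$, $(a;q)_0=1$, $(a;q)_\infty=\prod_{m=0}^{\infty}(1-aq^m)$ for $|q|<1$. Definition: $$F(\alpha,z;q)=\frac{1}{(-zq^2/\alpha;q^2)_\infty(zq^2;q^2)_\infty}\Bigg(\frac{q^2}{1+zq/\alpha}\sum_{m=0}^{\infty}\frac{(-\alpha/(zq);q^2)_{m+1}}{(-zq;q^2)_{m+1}}(zq)^m-\frac{\alpha q}{z}\,\frac{(z^2q^2/\alpha;q^2)_\infty}{(z^2q^2;q^4)_{\infty}(z^2q^2/\alpha^2;q^{4})_{\infty}}\sum_{n=0}^{\infty}\alpha^nq^{n^2+n}\Bigg).$$ *)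

theory Defs
  imports "HOL-Analysis.Analysis"
begin

definition qpoch :: "complex \<Rightarrow> complex \<Rightarrow> nat \<Rightarrow> complex" where
  "qpoch a q n = (\<Prod>m<n. 1 - a * q ^ m)"

(* Intended for norm q < 1, where the product converges. Vanishing factors are allowed:
   in that case the value is 0. *)
definition qpoch_inf :: "complex \<Rightarrow> complex \<Rightarrow> complex" where
  "qpoch_inf a q = (\<Prod>m. 1 - a * q ^ m)"

(* Meaningful for nonzero \<alpha>, z, q with norm q < 1, norm (z * q) < 1 and
   norm (z * q / \<alpha>) < 1: then no denominator vanishes and both series converge. *)
definition F :: "complex \<Rightarrow> complex \<Rightarrow> complex \<Rightarrow> complex" where
  "F \<alpha> z q =
     1 / (qpoch_inf (- z * q^2 / \<alpha>) (q^2) * qpoch_inf (z * q^2) (q^2)) *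
     (q^2 / (1 + z * q / \<alpha>) *
        (\<Sum>m. qpoch (- \<alpha> / (z * q)) (q^2) (m + 1) / qpoch (- z * q) (q^2) (m + 1) * (z * q) ^ m)
      - \<alpha> * q / z *
        (qpoch_inf (z^2 * q^2 / \<alpha>) (q^2) /
           (qpoch_inf (z^2 * q^2) (q^4) * qpoch_inf (z^2 * q^2 / \<alpha>^2) (q^4))) *
        (\<Sum>n. \<alpha> ^ n * q ^ (n^2 + n)))"

end

theory Submission
  imports Defs
begin

text \<open>
  Put \<open>p = q\<^sup>2\<close>, \<open>x = z q\<close> and \<open>y = - z q / \<alpha>\<close>, so that \<open>\<alpha> = - x / y\<close>. The substitution
  \<open>(\<alpha>, z) \<mapsto> (1 / \<alpha>, - z / \<alpha>)\<close> then merely exchanges \<open>x\<close> and \<open>y\<close>. It fixes the prefactor of \<open>F\<close>,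
  and what remains in the bracket is \<open>q\<^sup>2\<close> times
  \[ T(x,y) + \frac{1}{y}\,\frac{(-xy;p)_\infty}{(x^2;p^2)_\infty (y^2;p^2)_\infty}
      \sum_{m \ge 0} (-x/y)^m p^{m(m+1)/2}, \qquad
     T(x,y) = -\frac{1}{y} \sum_{m \ge 0} \frac{(p/y;p)_m}{(-x;p)_{m+1}}\, x^m . \]
  The claim is that this expression is symmetric in \<open>x\<close> and \<open>y\<close>.

  The series \<open>T\<close> itself is not symmetric, but it satisfies a first-order recurrence under
  \<open>(x, y) \<mapsto> (xp, yp)\<close> all of whose coefficients are symmetric (\<open>half_sum_recurrence\<close>):
  \[ (1-x^2)(1-y^2)\, T(x,y) = (x+y) + p\,(1+xy)(1+xyp)\, T(xp,yp) . \]
  It comes from a telescoping identity between the summands of the two series. Iterating it writes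
  \<open>T(x,y)\<close> as a partial sum of a symmetric series plus a remainder, which is an explicit product
  times \<open>p\<^sup>N T(xp\<^sup>N, yp\<^sup>N)\<close>. Since this scaling preserves the ratio \<open>x / y\<close>, the latter
  tends to \<open>- 1 / y\<close> times the partial theta function in \<open>- x / y\<close> (\<open>half_sum_scaled_tendsto\<close>), and
  the remainder tends to minus the theta term in the bracket. Hence the bracket is the sum of the symmetric series
  (\<open>half_sum_eq_symmetric_series\<close>).
\<close>

section \<open>Infinite products\<close>

lemma qpoch_Suc: "qpoch a p (Suc n) = qpoch a p n * (1 - a * p ^ n)"
  by (simp add: qpoch_def)

lemma qpoch_Suc_shift: "qpoch a p (Suc n) = (1 - a) * qpoch (a * p) p n"
  unfolding qpoch_def prod.lessThan_Suc_shift by (simp add: mult_ac)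

lemma norm_mult_power_less_1:
  fixes a p :: complex
  assumes "norm a < 1" "norm p \<le> 1"
  shows "norm (a * p ^ n) < 1"
proof -
  have "norm (a * p ^ n) \<le> norm a * 1"
    unfolding norm_mult norm_power
    by (intro mult_left_mono power_le_one) (use assms in auto)
  with assms show ?thesis by simp
qed

lemma one_minus_mult_power_nonzero:
  fixes a p :: complex
  assumes "norm a < 1" "norm p \<le> 1"
  shows "1 - a * p ^ n \<noteq> 0"
  using norm_mult_power_less_1[OF assms, of n] by auto

lemma qpoch_nonzero:
  assumes "norm a < 1" "norm p \<le> 1"
  shows "qpoch a p n \<noteq> 0"
  using one_minus_mult_power_nonzero[OF assms] by (simp add: qpoch_def)

lemma convergent_prod_qpoch:
  fixes a p :: complex
  assumes "norm p < 1"
  shows "convergent_prod (\<lambda>m. 1 - a * p ^ m)"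
proof -
  have "summable (\<lambda>m. norm a * norm p ^ m)"
    using assms by (intro summable_mult summable_geometric) auto
  then have "abs_convergent_prod (\<lambda>m. 1 - a * p ^ m)"
    by (simp add: abs_convergent_prod_conv_summable norm_mult norm_power)
  then show ?thesis
    by (rule abs_convergent_prod_imp_convergent_prod)
qed

lemma qpoch_tendsto_qpoch_inf:
  assumes "norm p < 1"
  shows "qpoch a p \<longlonglongrightarrow> qpoch_inf a p"
  unfolding qpoch_def qpoch_inf_def
  using convergent_prod_LIMSEQ[OF convergent_prod_qpoch[OF assms, of a]]
  by (simp add: LIMSEQ_lessThan_iff_atMost)

lemma qpoch_inf_nonzero:
  assumes "norm a < 1" "norm p < 1"
  shows "qpoch_inf a p \<noteq> 0"
  unfolding qpoch_inf_def
  using assms by (intro prodinf_nonzero convergent_prod_qpoch one_minus_mult_power_nonzero) auto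

section \<open>The one-sided series and its degeneration to a partial theta function\<close>

text \<open>
  For \<open>t = x / y\<close> this is \<open>(p/y; p)\<^sub>m x\<^sup>m / (-x; p)\<^sub>m\<^sub>+\<^sub>1\<close> with the power of \<open>x\<close> distributed over the
  factors. In this form the parameter \<open>t\<close> can be kept fixed while \<open>x\<close> tends to \<open>0\<close>, and the limit
  is simply the value at \<open>x = 0\<close>.
\<close>

definition half_term :: "complex \<Rightarrow> complex \<Rightarrow> complex \<Rightarrow> nat \<Rightarrow> complex" where
  "half_term p t x m = (\<Prod>j<m. x - t * p ^ Suc j) / qpoch (- x) p (Suc m)"

definition half_sum :: "complex \<Rightarrow> complex \<Rightarrow> complex \<Rightarrow> complex" where
  "half_sum p x y = - (1 / y) * (\<Sum>m. half_term p (x / y) x m)"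

text \<open>
  The majorant depends on \<open>x\<close> only through a bound \<open>r < 1\<close> on its norm, so that it dominates the
  terms for all the arguments \<open>x p\<^sup>N\<close> at once.
\<close>

definition half_majorant :: "real \<Rightarrow> real \<Rightarrow> real \<Rightarrow> nat \<Rightarrow> real" where
  "half_majorant \<rho> \<tau> r m = (\<Prod>j<m. r + \<tau> * \<rho> ^ Suc j) / (\<Prod>j<Suc m. 1 - r * \<rho> ^ j)"

lemma norm_half_term_le:
  assumes "norm u \<le> r" "r < 1" "norm p < 1"
  shows "norm (half_term p t u m) \<le> half_majorant (norm p) (norm t) r m"
proof -
  have r0: "0 \<le> r"
    using assms(1) norm_ge_zero order_trans by blast
  have pos: "0 < 1 - r * norm p ^ j" for j
  proof -
    have "r * norm p ^ j \<le> r * 1"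
      using assms r0 by (intro mult_left_mono power_le_one) auto
    with assms show ?thesis by simp
  qed
  have num: "norm (u - t * p ^ Suc j) \<le> r + norm t * norm p ^ Suc j" for j
    using norm_triangle_ineq4[of u "t * p ^ Suc j"] assms(1)
    unfolding norm_mult norm_power by linarith
  have den: "1 - r * norm p ^ j \<le> norm (1 - - u * p ^ j)" for j
  proof -
    have "1 - norm (u * p ^ j) \<le> norm (1 - - u * p ^ j)"
      using norm_triangle_ineq2[of 1 "- u * p ^ j"] by simp
    moreover have "norm (u * p ^ j) \<le> r * norm p ^ j"
      using assms by (simp add: norm_mult norm_power mult_right_mono)
    ultimately show ?thesis by linarith
  qed
  show ?thesis
    unfolding half_term_def half_majorant_def qpoch_def norm_divide prod_norm[symmetric]
  proof (rule frac_le)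
    show "(\<Prod>j<m. norm (u - t * p ^ Suc j)) \<le> (\<Prod>j<m. r + norm t * norm p ^ Suc j)"
      using num by (intro prod_mono) auto
    show "0 \<le> (\<Prod>j<m. r + norm t * norm p ^ Suc j)"
      using r0 by (intro prod_nonneg) auto
    show "0 < (\<Prod>j<Suc m. 1 - r * norm p ^ j)"
      using pos by (intro prod_pos) auto
    show "(\<Prod>j<Suc m. 1 - r * norm p ^ j) \<le> (\<Prod>j<Suc m. norm (1 - - u * p ^ j))"
      using den less_imp_le[OF pos] by (intro prod_mono) auto
  qed
qed

text \<open>
  The ratio of consecutive terms tends to \<open>r < 1\<close>, because the contribution of \<open>\<tau>\<close> carries a
  power of \<open>\<rho>\<close>; thus \<open>\<tau>\<close> may be arbitrarily large.
\<close>

lemma summable_half_majorant: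
  assumes "0 \<le> \<rho>" "\<rho> < 1" "0 \<le> \<tau>" "0 \<le> r" "r < 1"
  shows "summable (half_majorant \<rho> \<tau> r)"
proof -
  define c where "c = (1 + r) / 2"
  define k where "k = (\<lambda>m. (r + \<tau> * \<rho> ^ Suc m) / (1 - r * \<rho> ^ Suc m))"
  have pow: "(\<lambda>m. \<rho> ^ Suc m) \<longlonglongrightarrow> 0"
    using LIMSEQ_Suc[OF LIMSEQ_realpow_zero[OF assms(1,2)]] .
  have "k \<longlonglongrightarrow> (r + \<tau> * 0) / (1 - r * 0)"
    unfolding k_def by (intro tendsto_intros pow) auto
  then have "k \<longlonglongrightarrow> r" by simp
  moreover have "r < c"
    using assms by (simp add: c_def)
  ultimately have "eventually (\<lambda>m. k m < c) sequentially"
    by (rule order_tendstoD(2))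
  then obtain N where N: "\<And>m. m \<ge> N \<Longrightarrow> k m < c"
    by (auto simp: eventually_sequentially)
  have pos: "0 < 1 - r * \<rho> ^ j" for j
  proof -
    have "r * \<rho> ^ j \<le> r * 1"
      using assms by (intro mult_left_mono power_le_one) auto
    with assms show ?thesis by simp
  qed
  have nonneg: "0 \<le> half_majorant \<rho> \<tau> r m" for m
    unfolding half_majorant_def using assms less_imp_le[OF pos]
    by (intro divide_nonneg_nonneg prod_nonneg) auto
  have step: "half_majorant \<rho> \<tau> r (Suc m) = k m * half_majorant \<rho> \<tau> r m" for m
    by (simp add: half_majorant_def k_def field_simps)
  show ?thesis
  proof (rule summable_ratio_test)
    show "c < 1" using assms by (simp add: c_def)
    fix m assume "N \<le> m"
    then have "k m * half_majorant \<rho> \<tau> r m \<le> c * half_majorant \<rho> \<tau> r m"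
      using N[of m] nonneg by (intro mult_right_mono) auto
    then show "norm (half_majorant \<rho> \<tau> r (Suc m)) \<le> c * norm (half_majorant \<rho> \<tau> r m)"
      using nonneg[of m] nonneg[of "Suc m"] by (simp add: step)
  qed
qed

lemma summable_half_term:
  assumes "norm x < 1" "norm p < 1"
  shows "summable (half_term p t x)"
  by (rule summable_comparison_test'[OF summable_half_majorant[of "norm p" "norm t" "norm x"]])
     (use assms norm_half_term_le[of x "norm x" p t] in auto)

text \<open>
  Scaling both arguments by \<open>p\<^sup>N\<close> leaves their ratio alone, and the factor \<open>p\<^sup>N\<close> cancels against
  the prefactor \<open>1 / (y p\<^sup>N)\<close>. Termwise the limit puts \<open>x = 0\<close> in the summand, and
  Tannery's theorem permits the limit inside the sum.
\<close>

lemma half_sum_scaled_tendsto: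
  assumes "norm x < 1" "norm p < 1" "p \<noteq> 0" "y \<noteq> 0"
  shows "(\<lambda>N. p ^ N * half_sum p (x * p ^ N) (y * p ^ N))
           \<longlonglongrightarrow> - (1 / y) * (\<Sum>m. \<Prod>j<m. - (x / y) * p ^ Suc j)"
proof -
  define t where "t = x / y"
  have scale: "(\<lambda>N. x * p ^ N) \<longlonglongrightarrow> 0"
    using tendsto_mult[OF tendsto_const[of x] LIMSEQ_power_zero[OF assms(2)]] by simp
  have lim: "(\<lambda>N. half_term p t (x * p ^ N) m) \<longlonglongrightarrow> (\<Prod>j<m. - t * p ^ Suc j)" for m
  proof -
    have "(\<lambda>N. half_term p t (x * p ^ N) m) \<longlonglongrightarrow>
            (\<Prod>j<m. 0 - t * p ^ Suc j) / (\<Prod>j<Suc m. 1 - - 0 * p ^ j)"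
      unfolding half_term_def qpoch_def by (intro tendsto_intros scale) auto
    then show ?thesis by simp
  qed
  have bound: "norm (half_term p t (x * p ^ N) m) \<le> half_majorant (norm p) (norm t) (norm x) m" for m N
  proof (rule norm_half_term_le)
    show "norm (x * p ^ N) \<le> norm x"
      unfolding norm_mult norm_power
      using assms by (intro mult_left_le power_le_one) auto
  qed (use assms in auto)
  then have ev: "eventually (\<lambda>(m, N). norm (half_term p t (x * p ^ N) m)
      \<le> half_majorant (norm p) (norm t) (norm x) m) (at_top \<times>\<^sub>F sequentially)"
    by (intro always_eventually) auto
  have summ: "summable (half_majorant (norm p) (norm t) (norm x))"
    using assms by (intro summable_half_majorant) auto
  have "(\<lambda>N. \<Sum>m. half_term p t (x * p ^ N) m) \<longlonglongrightarrow> (\<Sum>m. \<Prod>j<m. - t * p ^ Suc j)"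
    using tannerys_theorem[of "\<lambda>m N. half_term p t (x * p ^ N) m", OF lim ev summ]
    by simp
  then have "(\<lambda>N. - (1 / y) * (\<Sum>m. half_term p t (x * p ^ N) m))
      \<longlonglongrightarrow> - (1 / y) * (\<Sum>m. \<Prod>j<m. - t * p ^ Suc j)"
    by (rule tendsto_mult_left)
  moreover have "p ^ N * half_sum p (x * p ^ N) (y * p ^ N) =
      - (1 / y) * (\<Sum>m. half_term p t (x * p ^ N) m)" for N
    using assms by (simp add: half_sum_def t_def)
  ultimately show ?thesis
    by (simp only: t_def)
qed

section \<open>The symmetric recurrence\<close>

text \<open>
  Up to common factors, the summands of the series at \<open>(x, y)\<close> and at \<open>(xp, yp)\<close> are one
  hypergeometric term multiplied by polynomials in \<open>X = p\<^sup>m\<close>. A summation certificate is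
  sought as such a term times a polynomial of degree one in \<open>X\<close>; comparing the coefficients of
  \<open>X\<^sup>0\<close> and \<open>X\<^sup>2\<close> forces the polynomial to be a multiple of \<open>1 + y - (1 - x) X\<close>, and the coefficient of
  \<open>X\<^sup>1\<close> then agrees as well.
\<close>

lemma half_term_telescope:
  fixes p x y :: complex
  assumes "norm x < 1" "norm p \<le> 1" "x \<noteq> 0" "y \<noteq> 0"
  defines "G \<equiv> \<lambda>m. y * (1 + x) * (1 + y - (1 - x) * p ^ m) *
                 (\<Prod>j<m. x - (x / y) * p ^ j) / qpoch (- x) p (Suc m)"
  shows "(1 - x^2) * (1 - y^2) * half_term p (x / y) x m
       - (1 + x * y) * (1 + x * y * p) * half_term p (x / y) (x * p) m = G (Suc m) - G m"
proof -
  define t where "t = x / y"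
  define A where "A = (\<Prod>j<m. x - t * p ^ Suc j)"
  define B where "B = (\<Prod>j<m. x - t * p ^ j)"
  define X where "X = p ^ m"
  define Q where "Q = qpoch (- x) p (Suc m)"
  define d where "d = 1 + x * p * X"
  have x1: "1 + x \<noteq> 0"
    using one_minus_mult_power_nonzero[of "- x" p 0] assms by simp
  have Q0: "Q \<noteq> 0"
    unfolding Q_def using assms by (intro qpoch_nonzero) auto
  have d0: "d \<noteq> 0"
    using one_minus_mult_power_nonzero[of "- x" p "Suc m"] assms by (simp add: d_def X_def mult_ac)
  have Q': "qpoch (- x) p (Suc (Suc m)) = Q * d"
    by (subst qpoch_Suc) (simp add: Q_def d_def X_def mult_ac)
  have Q'': "qpoch (- (x * p)) p (Suc m) = Q * d / (1 + x)"
    using qpoch_Suc_shift[of "- x" p "Suc m"] x1 by (simp add: Q' field_simps)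
  have A': "(\<Prod>j<m. x * p - t * p ^ Suc j) = X * B"
  proof -
    have "(\<Prod>j<m. x * p - t * p ^ Suc j) = (\<Prod>j<m. p * (x - t * p ^ j))"
      by (simp add: algebra_simps)
    then show ?thesis
      by (simp add: prod.distrib B_def X_def)
  qed
  have "(x - t) * A = B * (x - t * X)"
    using prod.lessThan_Suc_shift[of "\<lambda>j. x - t * p ^ j" m]
    by (simp add: A_def B_def X_def mult_ac)
  then have "x * ((1 - y) * A) = x * (B * (X - y))"
    using assms(4) by (simp add: t_def field_simps)
  \<comment> \<open>The product \<open>A\<close> is \<open>B\<close> with its first factor removed and one more factor at the end.\<close>
  then have A_B: "(1 - y) * A = B * (X - y)"
    using assms(3) by simp
  have poly: "(1 - x^2) * (1 - y^2) * A * d - (1 + x * y) * (1 + x * y * p) * (1 + x) * (X * B)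
     = (1 + x) * ((1 + y - (1 - x) * (X * p)) * (B * (x * y - x * X)) -
                  y * (1 + y - (1 - x) * X) * B * d)"
  proof -
    have "(1 - x^2) * (1 - y^2) * A * d = (1 - x^2) * (1 + y) * d * ((1 - y) * A)"
      by (simp add: power2_eq_square algebra_simps)
    then show ?thesis
      unfolding A_B d_def by (simp add: power2_eq_square algebra_simps)
  qed
  have G_m: "G m = y * (1 + x) * (1 + y - (1 - x) * X) * B / Q"
    by (simp add: G_def B_def Q_def X_def t_def)
  have B_Suc: "(\<Prod>j<Suc m. x - t * p ^ j) = B * (x * y - x * X) / y"
    using assms(4) by (simp add: B_def X_def t_def field_simps)
  have G_Suc: "G (Suc m) = (1 + x) * (1 + y - (1 - x) * (X * p)) * (B * (x * y - x * X)) / (Q * d)"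
    unfolding G_def t_def[symmetric] Q' B_Suc using assms(4) by (simp add: X_def mult_ac)
  have "(1 - x^2) * (1 - y^2) * (A / Q) - (1 + x * y) * (1 + x * y * p) * (X * B / (Q * d / (1 + x)))
      = ((1 - x^2) * (1 - y^2) * A * d - (1 + x * y) * (1 + x * y * p) * (1 + x) * (X * B)) / (Q * d)"
    using Q0 d0 x1 by (simp add: diff_divide_distrib mult_ac)
  also have "\<dots> = G (Suc m) - G m"
    unfolding poly G_m G_Suc using Q0 d0 by (simp add: field_simps)
  finally show ?thesis
    unfolding half_term_def t_def[symmetric] A_def[symmetric] Q_def[symmetric] A' Q'' .
qed

text \<open>
  Summing the telescoping identity leaves only the boundary value at \<open>m = 0\<close>, which is
  \<open>y (x + y)\<close>. After division by \<open>- y\<close> the inhomogeneous term is \<open>x + y\<close>: this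
  symmetry is what the whole argument rests on.
\<close>

lemma half_sum_recurrence:
  fixes p x y :: complex
  assumes "norm x < 1" "norm p < 1" "p \<noteq> 0" "x \<noteq> 0" "y \<noteq> 0"
  shows "(1 - x^2) * (1 - y^2) * half_sum p x y
       = (x + y) + p * (1 + x * y) * (1 + x * y * p) * half_sum p (x * p) (y * p)"
proof -
  define t where "t = x / y"
  define G where "G = (\<lambda>m. y * (1 + x) * (1 + y - (1 - x) * p ^ m) *
                 (\<Prod>j<m. x - t * p ^ j) / qpoch (- x) p (Suc m))"
  have x1: "1 + x \<noteq> 0"
    using one_minus_mult_power_nonzero[of "- x" p 0] assms by simp
  have xp: "norm (x * p) < 1"
    using norm_mult_power_less_1[of x p 1] assms by simp
  note summ = summable_half_term[OF assms(1,2), of t] summable_half_term[OF xp assms(2), of t]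
  have pow: "(\<lambda>m. p ^ m) \<longlonglongrightarrow> 0"
    by (rule LIMSEQ_power_zero[OF assms(2)])
  have G_Suc: "G (Suc m) = y * (1 + x) * (1 + y - (1 - x) * p ^ Suc m) * ((x - t) * half_term p t x m)
                 / (1 - - x * p ^ Suc m)" for m
    unfolding G_def qpoch_Suc[of _ _ "Suc m"] prod.lessThan_Suc_shift half_term_def
    by simp
  have "(\<lambda>m. G (Suc m)) \<longlonglongrightarrow>
      y * (1 + x) * (1 + y - (1 - x) * 0) * ((x - t) * 0) / (1 - - x * 0)"
    unfolding G_Suc by (intro tendsto_intros summable_LIMSEQ_zero summ LIMSEQ_Suc[OF pow]) auto
  then have "G \<longlonglongrightarrow> 0"
    by (intro LIMSEQ_imp_Suc[of G]) simp
  then have "(\<lambda>m. G (Suc m) - G m) sums (0 - G 0)"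
    by (rule telescope_sums)
  moreover have "G (Suc m) - G m = (1 - x^2) * (1 - y^2) * half_term p t x m
       - (1 + x * y) * (1 + x * y * p) * half_term p t (x * p) m" for m
    unfolding G_def t_def using assms by (intro half_term_telescope[symmetric]) auto
  moreover have "0 - G 0 = - y * (x + y)"
    using x1 by (simp add: G_def qpoch_def field_simps)
  ultimately have "(\<lambda>m. (1 - x^2) * (1 - y^2) * half_term p t x m
       - (1 + x * y) * (1 + x * y * p) * half_term p t (x * p) m) sums (- y * (x + y))"
    by simp
  moreover have "(\<lambda>m. (1 - x^2) * (1 - y^2) * half_term p t x m
       - (1 + x * y) * (1 + x * y * p) * half_term p t (x * p) m) sums
      ((1 - x^2) * (1 - y^2) * (\<Sum>m. half_term p t x m)
       - (1 + x * y) * (1 + x * y * p) * (\<Sum>m. half_term p t (x * p) m))"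
    by (intro sums_diff sums_mult summable_sums summ)
  ultimately have "(1 - x^2) * (1 - y^2) * (\<Sum>m. half_term p t x m)
       - (1 + x * y) * (1 + x * y * p) * (\<Sum>m. half_term p t (x * p) m) = - y * (x + y)"
    using sums_unique2 by blast
  then have eq: "(1 - x^2) * (1 - y^2) * (\<Sum>m. half_term p t x m)
       = (1 + x * y) * (1 + x * y * p) * (\<Sum>m. half_term p t (x * p) m) - y * (x + y)"
    by (simp add: algebra_simps)
  have "(1 - x^2) * (1 - y^2) * half_sum p x y
      = - (1 / y) * ((1 - x^2) * (1 - y^2) * (\<Sum>m. half_term p t x m))"
    by (simp add: half_sum_def t_def)
  also have "\<dots> = (x + y) + (1 + x * y) * (1 + x * y * p) * (- (1 / y) * (\<Sum>m. half_term p t (x * p) m))"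
    unfolding eq using assms(5) by (simp add: field_simps)
  also have "- (1 / y) * (\<Sum>m. half_term p t (x * p) m) = p * half_sum p (x * p) (y * p)"
    using assms(3) by (simp add: half_sum_def t_def)
  finally show ?thesis
    by (simp add: mult_ac)
qed

section \<open>The symmetric series\<close>

text \<open>The product of the first \<open>n\<close> coefficients of the iterated recurrence, without their powers of \<open>p\<close>.\<close>

definition sym_weight :: "complex \<Rightarrow> complex \<Rightarrow> complex \<Rightarrow> nat \<Rightarrow> complex" where
  "sym_weight p x y n =
     qpoch (- (x * y)) p (2 * n) / (qpoch (x^2) (p^2) n * qpoch (y^2) (p^2) n)"

definition sym_term :: "complex \<Rightarrow> complex \<Rightarrow> complex \<Rightarrow> nat \<Rightarrow> complex" where
  "sym_term p x y n = sym_weight p x y n * ((x + y) * p ^ (2 * n)) /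
     ((1 - x^2 * p ^ (2 * n)) * (1 - y^2 * p ^ (2 * n)))"

lemma sym_term_commute: "sym_term p x y = sym_term p y x"
  by (simp add: fun_eq_iff sym_term_def sym_weight_def mult_ac add_ac)

lemma half_sum_iterate:
  fixes p x y :: complex
  assumes "norm x < 1" "norm y < 1" "norm p < 1" "p \<noteq> 0" "x \<noteq> 0" "y \<noteq> 0"
  shows "half_sum p x y = (\<Sum>n<N. sym_term p x y n) +
           sym_weight p x y N * (p ^ N * half_sum p (x * p ^ N) (y * p ^ N))"
proof (induction N)
  case 0
  show ?case by (simp add: sym_weight_def qpoch_def)
next
  case (Suc N)
  define a where "a = 1 - x^2 * p ^ (2 * N)"
  define b where "b = 1 - y^2 * p ^ (2 * N)"
  define T where "T = half_sum p (x * p ^ N) (y * p ^ N)"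
  define T' where "T' = half_sum p (x * p ^ Suc N) (y * p ^ Suc N)"
  define c where "c = (1 + x * y * p ^ (2 * N)) * (1 + x * y * p ^ Suc (2 * N))"
  have sq: "norm (x^2) < 1" "norm (y^2) < 1" "norm (p^2) \<le> 1"
    using assms by (auto simp: norm_power power_less_one_iff power_le_one)
  have ab: "a \<noteq> 0" "b \<noteq> 0"
    using one_minus_mult_power_nonzero[OF sq(1,3), of N] one_minus_mult_power_nonzero[OF sq(2,3), of N]
    by (simp_all add: a_def b_def power_mult)
  have w: "sym_weight p x y (Suc N) = sym_weight p x y N * c / (a * b)"
    by (simp add: sym_weight_def qpoch_Suc a_def b_def c_def mult_ac flip: power_mult)
  have "norm (x * p ^ N) < 1"
    using assms by (intro norm_mult_power_less_1) auto
  from half_sum_recurrence[OF this assms(3,4), of "y * p ^ N"]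
  have rec: "(1 - (x * p ^ N)^2) * (1 - (y * p ^ N)^2) * T = (x * p ^ N + y * p ^ N) +
      p * (1 + (x * p ^ N) * (y * p ^ N)) * (1 + (x * p ^ N) * (y * p ^ N) * p) * T'"
    using assms by (simp add: T_def T'_def mult_ac)
  have scaled: "(x * p ^ N)^2 = x^2 * p ^ (2 * N)" "(y * p ^ N)^2 = y^2 * p ^ (2 * N)"
    "(x * p ^ N) * (y * p ^ N) = x * y * p ^ (2 * N)"
    by (simp_all add: power_mult_distrib power_even_eq power2_eq_square)
  have "a * b * T = (x + y) * p ^ N + p * c * T'"
    using rec unfolding scaled by (simp add: a_def b_def c_def distrib_right mult_ac)
  then have T: "T = ((x + y) * p ^ N + p * c * T') / (a * b)"
    using ab by (simp add: field_simps)
  have p2: "p ^ (2 * N) = p ^ N * p ^ N"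
    by (simp add: mult_2 power_add)
  have "sym_weight p x y N * (p ^ N * T)
      = sym_term p x y N + sym_weight p x y (Suc N) * (p ^ Suc N * T')"
    unfolding w sym_term_def a_def[symmetric] b_def[symmetric] T
    unfolding p2
    using ab by (simp add: field_simps)
  then show ?case
    using Suc.IH by (simp add: T_def T'_def)
qed

text \<open>
  In the iterated recurrence the weight of the remainder tends to the quotient of infinite products
  and the rescaled series to \<open>- 1 / y\<close> times the partial theta function, so the partial sums
  of the symmetric series converge.
\<close>

theorem half_sum_eq_symmetric_series:
  fixes p x y :: complex
  assumes "norm x < 1" "norm y < 1" "norm p < 1" "p \<noteq> 0" "x \<noteq> 0" "y \<noteq> 0"
  shows "sym_term p x y sums
     (half_sum p x y + qpoch_inf (- (x * y)) p / (qpoch_inf (x^2) (p^2) * qpoch_inf (y^2) (p^2)) *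
        (1 / y * (\<Sum>m. \<Prod>j<m. - (x / y) * p ^ Suc j)))"
proof -
  define W where "W = qpoch_inf (- (x * y)) p / (qpoch_inf (x^2) (p^2) * qpoch_inf (y^2) (p^2))"
  define \<Theta> where "\<Theta> = (\<Sum>m. \<Prod>j<m. - (x / y) * p ^ Suc j)"
  have sq: "norm (x^2) < 1" "norm (y^2) < 1" "norm (p^2) < 1"
    using assms by (auto simp: norm_power power_less_one_iff)
  have "strict_mono (\<lambda>n::nat. 2 * n)"
    by (auto simp: strict_mono_def)
  from LIMSEQ_subseq_LIMSEQ[OF qpoch_tendsto_qpoch_inf[OF assms(3)] this]
  have "(\<lambda>n. qpoch (- (x * y)) p (2 * n)) \<longlonglongrightarrow> qpoch_inf (- (x * y)) p"
    by (simp add: o_def)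
  then have "sym_weight p x y \<longlonglongrightarrow> W"
    unfolding sym_weight_def W_def
    by (intro tendsto_intros qpoch_tendsto_qpoch_inf) (use sq qpoch_inf_nonzero in auto)
  then have "(\<lambda>N. half_sum p x y -
        sym_weight p x y N * (p ^ N * half_sum p (x * p ^ N) (y * p ^ N)))
      \<longlonglongrightarrow> half_sum p x y - W * (- (1 / y) * \<Theta>)"
    unfolding \<Theta>_def using assms by (intro tendsto_intros half_sum_scaled_tendsto) auto
  moreover have "(\<Sum>n<N. sym_term p x y n) = half_sum p x y -
        sym_weight p x y N * (p ^ N * half_sum p (x * p ^ N) (y * p ^ N))" for N
    using half_sum_iterate[OF assms, of N] by simp
  ultimately show ?thesis
    by (simp add: sums_def W_def \<Theta>_def)
qed

section \<open>The transformation formula\<close>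

text \<open>
  The first factor of \<open>(1/y; p)\<^sub>m\<^sub>+\<^sub>1\<close> is \<open>1 - 1 / y\<close>; against \<open>1 / (1 - y)\<close> it leaves
  the prefactor \<open>- 1 / y\<close>.
\<close>

lemma half_sum_eq_qpoch_series:
  assumes "norm x < 1" "norm y < 1" "norm p < 1" "y \<noteq> 0"
  shows "1 / (1 - y) * (\<Sum>m. qpoch (1 / y) p (m + 1) / qpoch (- x) p (m + 1) * x ^ m) = half_sum p x y"
proof -
  have y1: "1 - y \<noteq> 0"
    using assms by auto
  have "qpoch (1 / y) p (m + 1) / qpoch (- x) p (m + 1) * x ^ m
      = (1 - 1 / y) * half_term p (x / y) x m" for m
  proof -
    have "(\<Prod>j<m. x - x / y * p ^ Suc j) = (\<Prod>j<m. x * (1 - 1 / y * p * p ^ j))"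
      by (simp add: algebra_simps)
    also have "\<dots> = x ^ m * qpoch (1 / y * p) p m"
      by (simp add: prod.distrib qpoch_def)
    finally show ?thesis
      by (simp add: half_term_def qpoch_Suc_shift[of "1 / y"])
  qed
  then have "(\<Sum>m. qpoch (1 / y) p (m + 1) / qpoch (- x) p (m + 1) * x ^ m)
      = (1 - 1 / y) * (\<Sum>m. half_term p (x / y) x m)"
    using assms by (simp only: suminf_mult summable_half_term)
  moreover have "1 / (1 - y) * (1 - 1 / y) = - (1 / y)"
    using y1 assms(4) by (simp add: field_simps)
  ultimately show ?thesis
    by (simp only: half_sum_def mult.assoc[symmetric])
qed

lemma partial_theta_prod: "(\<Prod>j<m. a * (q^2) ^ Suc j) = a ^ m * (q::complex) ^ (m^2 + m)"
  by (induction m) (simp_all add: power_add power_mult power2_eq_square algebra_simps)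

text \<open>
  Written with \<open>w = - z / \<alpha>\<close> in place of \<open>\<alpha>\<close>, the right-hand side below is visibly symmetric in
  \<open>z\<close> and \<open>w\<close>.
\<close>

lemma F_eq_symmetric_series:
  fixes q \<alpha> z w :: complex
  assumes "q \<noteq> 0" "z \<noteq> 0" "w \<noteq> 0" "norm q < 1" "norm (z * q) < 1" "norm (w * q) < 1"
    and \<alpha>: "\<alpha> = - z / w"
  shows "F \<alpha> z q = q^2 / (qpoch_inf (w * q^2) (q^2) * qpoch_inf (z * q^2) (q^2)) *
                     (\<Sum>n. sym_term (q^2) (z * q) (w * q) n)"
proof -
  define x where "x = z * q"
  define y where "y = w * q"
  have xy: "norm x < 1" "norm y < 1" "x \<noteq> 0" "y \<noteq> 0" "norm (q^2) < 1" "q^2 \<noteq> 0"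
    using assms by (auto simp: x_def y_def norm_power power_less_one_iff)
  have xoy: "- (x / y) = \<alpha>"
    using assms by (simp add: x_def y_def)
  have args: "- z * q^2 / \<alpha> = w * q^2" "z * q / \<alpha> = - y" "- \<alpha> / (z * q) = 1 / y" "- z * q = - x"
     "z^2 * q^2 = x^2" "x^2 / \<alpha> = - (x * y)" "x^2 / \<alpha>^2 = y^2" "\<alpha> * q / z = - (q^2 / y)"
     "q ^ 4 = (q^2)^2"
    using assms(1-3) unfolding \<alpha> x_def y_def
    by (simp_all add: power2_eq_square eval_nat_numeral)
  have "F \<alpha> z q = 1 / (qpoch_inf (w * q^2) (q^2) * qpoch_inf (z * q^2) (q^2)) * (q^2 *
      (half_sum (q^2) x y + qpoch_inf (- (x * y)) (q^2) / (qpoch_inf (x^2) ((q^2)^2) * qpoch_inf (y^2) ((q^2)^2)) *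
        (1 / y * (\<Sum>m. \<Prod>j<m. - (x / y) * (q^2) ^ Suc j))))"
    unfolding F_def args xoy partial_theta_prod half_sum_eq_qpoch_series[OF xy(1,2,5,4), symmetric]
    unfolding x_def[symmetric]
    by (simp add: algebra_simps)
  also have "half_sum (q^2) x y + qpoch_inf (- (x * y)) (q^2) / (qpoch_inf (x^2) ((q^2)^2) * qpoch_inf (y^2) ((q^2)^2)) *
        (1 / y * (\<Sum>m. \<Prod>j<m. - (x / y) * (q^2) ^ Suc j)) = (\<Sum>n. sym_term (q^2) x y n)"
    using half_sum_eq_symmetric_series[OF xy(1,2,5,6,3,4)] by (rule sums_unique)
  finally show ?thesis
    by (simp add: x_def y_def)
qed

theorem corollary4p2:
  fixes q \<alpha> z :: complex
  assumes "q \<noteq> 0" and "\<alpha> \<noteq> 0" and "z \<noteq> 0"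
    and "norm q < 1" and "norm (z * q) < 1" and "norm (z * q / \<alpha>) < 1"
  shows "F \<alpha> z q = F (1 / \<alpha>) (- z / \<alpha>) q"
proof -
  define w where "w = - z / \<alpha>"
  have w: "w \<noteq> 0" "norm (w * q) < 1" "\<alpha> = - z / w" "1 / \<alpha> = - w / z"
    using assms by (auto simp: w_def norm_mult norm_divide)
  have "F \<alpha> z q = F (1 / \<alpha>) w q"
    unfolding F_eq_symmetric_series[OF assms(1,3) w(1) assms(4,5) w(2,3)]
      F_eq_symmetric_series[OF assms(1) w(1) assms(3,4) w(2) assms(5) w(4)]
    by (simp add: sym_term_commute[of "q^2" "w * q" "z * q"] mult.commute[of "qpoch_inf (w * q^2) _"])
  then show ?thesis
    by (simp add: w_def)
qed

end
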